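(* Let $h$ be a complex Hadamard matrix of order $n$, let $A=\mathrm{diag}(1,e^{2\pi i/n},\dots,e^{2\pi(n-1)i/n})$ and $B=\frac1n h^*Ah$. Then $h$ is of the form $\Lambda_1F_n\Lambda_2$, where $\Lambda_1,\Lambda_2$ are diagonal matrices with unimodular entries on the main diagonal, if and only if $$\sigma_p(A,B,AB,BA)=\{(x,y,z_1,z_2)\in\mathbb{C}^4: x^n+y^n+(-1)^{n-1}(e^{2\pi i/n}z_1+z_2)^n=1\}.$$
   Context: A complex Hadamard matrix of order $n$ is an $n\times n$ complex matrix all of whose entries have modulus one and whose rows are mutually orthogonal. $F_n=[e^{2\pi i(k-1)(j-1)/n}]_{j,k=1}^n$ is the Fourier matrix. For square matrices $A_1,\dots,A_k$ of the same size, $\sigma_p(A_1,\dots,A_k)=\{(x_1,\dots,x_k)\in\mathbb{C}^k: x_1A_1+\dots+x_kA_k-I \text{ is not invertible}\}$. *)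

theory Defs
  imports Complex_Main "Jordan_Normal_Form.Schur_Decomposition"
begin

definition complex_hadamard :: "nat \<Rightarrow> complex mat \<Rightarrow> bool" where
  "complex_hadamard n h \<longleftrightarrow>
     h \<in> carrier_mat n n \<and>
     (\<forall>i<n. \<forall>j<n. cmod (h $$ (i, j)) = 1) \<and>
     (\<forall>i<n. \<forall>j<n. i \<noteq> j \<longrightarrow> row h i \<bullet>c row h j = 0)"

text \<open>Matrix indices start at 0, so the shifts by one in the usual exponent \<open>(k-1)(j-1)\<close> disappear.\<close>

definition fourier_mat :: "nat \<Rightarrow> complex mat" where
  "fourier_mat n =
     mat n n (\<lambda>(j, k). exp (2 * of_real pi * \<i> * of_nat k * of_nat j / of_nat n))"

definition unimodular_diagonal_mat :: "nat \<Rightarrow> complex mat \<Rightarrow> bool" where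
  "unimodular_diagonal_mat n D \<longleftrightarrow>
     D \<in> carrier_mat n n \<and> diagonal_mat D \<and> (\<forall>i<n. cmod (D $$ (i, i)) = 1)"

definition mat_lin_comb :: "nat \<Rightarrow> complex list \<Rightarrow> complex mat list \<Rightarrow> complex mat" where
  "mat_lin_comb n xs As = foldr (+) (map2 (\<lambda>x A. x \<cdot>\<^sub>m A) xs As) (0\<^sub>m n n)"

text \<open>Points of \<open>\<complex>\<^sup>k\<close> are represented as lists of length \<open>k\<close>; the matrices in \<open>As\<close> are
  meant to be of size \<open>n \<times> n\<close>.\<close>

definition proj_spectrum :: "nat \<Rightarrow> complex mat list \<Rightarrow> complex list set" where
  "proj_spectrum n As =
     {xs. length xs = length As \<and> \<not> invertible_mat (mat_lin_comb n xs As - 1\<^sub>m n)}"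

end

theory Submission
  imports Defs
begin

text \<open>
  Write \<open>w = exp (2 \<pi> \<i> / n)\<close>. The rows of \<open>h\<close> being orthogonal and unimodular, \<open>h / \<surd>n\<close> is
  unitary, so \<open>B\<close> is the unitary conjugate of \<open>A\<close> determined by \<open>h * B = A * h\<close>. Both directions
  compare \<open>A\<close> and \<open>B\<close> with the clock and shift matrices, whose characteristic feature is the
  Weyl commutation relation \<open>A * B = w \<cdot>\<^sub>m (B * A)\<close>.

  If \<open>h\<close> has entries \<open>a j * w ^ (j * l) * c l\<close>, then \<open>h * B = A * h\<close> is solved by the weighted
  cyclic shift with weights \<open>c l / c (l + 1)\<close>, so \<open>B\<close> is this shift. The matrix
  \<open>x A + y B + z\<^sub>1 A B + z\<^sub>2 B A - I\<close> then has only a diagonal and a cyclic subdiagonal, and its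
  determinant is the sum of two products of linear factors over the \<open>n\<close>-th roots of unity, which
  are evaluated by \<open>\<Prod>l<n. (u - v w ^ l) = u ^ n - v ^ n\<close>
  (lemma \<open>det_weighted_shift_pencil\<close>).

  Conversely, the commutator of \<open>A\<close> and \<open>B\<close> is read off the slice \<open>x = y = 0\<close> of the spectrum. Let \<open>\<mu>\<close> be an eigenvalue of the
  unitary commutator \<open>C = A B A\<^sup>* B\<^sup>*\<close>; then \<open>A B - \<mu> B A\<close> is singular. Were \<open>\<mu> \<noteq> w\<close>, the slice
  would make all \<open>n\<close> roots \<open>z\<close> of \<open>z ^ n = (-1) ^ (n - 1) * (w - \<mu>) ^ n\<close> eigenvalues of
  \<open>A B - \<mu> B A\<close> as well, and together with \<open>0\<close> these are \<open>n + 1\<close> eigenvalues of an \<open>n \<times> n\<close>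
  matrix. So \<open>w\<close> is the only eigenvalue of \<open>C\<close>, the trace of \<open>C\<close> is \<open>n w\<close>, and a unitary matrix
  whose trace has the largest possible modulus is scalar. This gives the Weyl relation
  (lemma \<open>weyl_relation_if_pencil_singular\<close>). Since the diagonal entries of \<open>A\<close> are distinct, the
  relation forces \<open>B\<close> to be a weighted cyclic shift, and \<open>h * B = A * h\<close> becomes a recursion which
  produces each column of \<open>h\<close> from the previous one, up to a scalar, by multiplication with
  \<open>w ^ j\<close> in row \<open>j\<close>
  (lemma \<open>fourier_entries_if_weyl_relation\<close>).
\<close>

section \<open>Powers of a primitive root of unity\<close>

definition unit_root :: "nat \<Rightarrow> complex" where
  "unit_root n = exp (2 * of_real pi * \<i> / of_nat n)"

lemma exp_eq_unit_root_power:
  "exp (2 * of_real pi * \<i> * of_nat k / of_nat n) = unit_root n ^ k"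
  unfolding unit_root_def exp_of_nat_mult[symmetric] by (simp add: mult_ac)

lemma unit_root_power_eq_cis: "unit_root n ^ k = cis (2 * pi * real k / real n)"
  unfolding exp_eq_unit_root_power[symmetric] cis_conv_exp by (simp add: mult_ac)

lemma unit_root_neq_0 [simp]: "unit_root n \<noteq> 0"
  by (simp add: unit_root_def)

lemma norm_unit_root [simp]: "cmod (unit_root n) = 1"
  using unit_root_power_eq_cis[of n 1] by simp

lemma bij_betw_unit_root_power:
  assumes "n > 0"
  shows "bij_betw (\<lambda>k. unit_root n ^ k) {..<n} {z. z ^ n = 1}"
  using bij_betw_roots_unity[OF assms] by (simp add: unit_root_power_eq_cis)

lemma unit_root_power_n [simp]: "n > 0 \<Longrightarrow> unit_root n ^ n = 1"
  by (simp add: unit_root_power_eq_cis)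

lemma unit_root_power_mod: "unit_root n ^ (k mod n) = unit_root n ^ k"
proof (cases "n = 0")
  case False
  have "unit_root n ^ k = unit_root n ^ (n * (k div n) + k mod n)" by simp
  also have "\<dots> = unit_root n ^ (k mod n)"
    using False by (simp only: power_add power_mult) simp
  finally show ?thesis ..
qed simp

lemma unit_root_power_inj:
  assumes "unit_root n ^ i = unit_root n ^ j" "i < n" "j < n"
  shows "i = j"
  using bij_betw_unit_root_power[of n] assms by (auto simp: bij_betw_def dest: inj_onD)

text \<open>
  The homogeneous form of the factorisation of \<open>X ^ n - 1\<close> into linear factors: after dividing by
  \<open>v\<close>, both sides are values of monic polynomials of degree \<open>n\<close> with the same \<open>n\<close> roots. For
  \<open>v = 0\<close> the identity is trivial.
\<close>

lemma prod_diff_unit_root: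
  fixes u v :: complex
  assumes n: "n > 0"
  shows "(\<Prod>l<n. u - v * unit_root n ^ l) = u ^ n - v ^ n"
proof (cases "v = 0")
  case False
  define p where "p = (\<Prod>l<n. [:- (unit_root n ^ l), 1:])"
  define q where "q = (monom 1 n - 1 :: complex poly)"
  have "p = q"
  proof (rule poly_eqI_degree_lead_coeff[where n = n and A = "{z. z ^ n = 1}"])
    have deg: "degree p = n"
      unfolding p_def by (subst degree_prod_eq_sum_degree) auto
    then show "degree p \<le> n" by simp
    have "lead_coeff p = 1" unfolding p_def by (simp add: lead_coeff_prod)
    with deg n show "coeff p n = coeff q n" by (simp add: q_def)
    show "card {z::complex. z ^ n = 1} \<ge> n" using card_roots_unity_eq[OF n] by simp
    show "degree q \<le> n" unfolding q_def by (intro degree_diff_le) (auto simp: degree_monom_le)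
    show "poly p z = poly q z" if "z \<in> {z. z ^ n = 1}" for z
    proof -
      have "z \<in> (\<lambda>k. unit_root n ^ k) ` {..<n}"
        using that bij_betw_unit_root_power[OF n] by (simp add: bij_betw_def)
      then have "poly p z = 0" by (auto simp: p_def poly_prod)
      then show ?thesis using that by (simp add: q_def poly_monom)
    qed
  qed
  then have "poly p (u / v) = poly q (u / v)" by simp
  then have *: "(\<Prod>l<n. u / v - unit_root n ^ l) = (u / v) ^ n - 1"
    by (simp add: p_def q_def poly_prod poly_monom)
  have "(\<Prod>l<n. u - v * unit_root n ^ l) = (\<Prod>l<n. v * (u / v - unit_root n ^ l))"
    using False by (intro prod.cong) (auto simp: field_simps)
  also have "\<dots> = v ^ n * ((u / v) ^ n - 1)"
    by (simp add: prod.distrib *)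
  also have "\<dots> = u ^ n - v ^ n"
    using False by (simp add: field_simps)
  finally show ?thesis .
qed (use n in \<open>simp add: power_0_left\<close>)

section \<open>Cyclic bidiagonal matrices\<close>

text \<open>
  The diagonal and the cyclic subdiagonal are added, and not selected by cases, because for
  \<open>n = 1\<close> they are the same position.
\<close>

definition cyclic_bidiagonal :: "nat \<Rightarrow> (nat \<Rightarrow> 'a::comm_ring_1) \<Rightarrow> (nat \<Rightarrow> 'a) \<Rightarrow> 'a mat" where
  "cyclic_bidiagonal n d e =
     mat n n (\<lambda>(i, j). (if i = j then d j else 0) + (if i = Suc j mod n then e j else 0))"

text \<open>
  Row \<open>0\<close> meets only the diagonal and the wrapped-around end of the subdiagonal. Deleting the first
  row with the first column leaves a lower triangular matrix with diagonal \<open>d\<close>; deleting it with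
  the last column moves the subdiagonal onto the diagonal of an upper triangular matrix.
\<close>

lemma det_cyclic_bidiagonal:
  fixes d e :: "nat \<Rightarrow> 'a::comm_ring_1"
  assumes n: "n > 0"
  shows "det (cyclic_bidiagonal n d e) = (\<Prod>j<n. d j) + (-1) ^ (n - 1) * (\<Prod>j<n. e j)"
proof -
  obtain m where m: "n = Suc m" using n by (cases n) auto
  let ?M = "cyclic_bidiagonal n d e"
  have M: "?M \<in> carrier_mat n n" by (simp add: cyclic_bidiagonal_def)
  have wrap: "(0 = Suc j mod n) \<longleftrightarrow> j = m" if "j < n" for j
    using that by (cases "j = m") (auto simp: m)
  have entry0: "?M $$ (0, j) = (if j = 0 then d 0 else 0) + (if j = m then e m else 0)"
    if "j < n" for j
    using that n wrap[of j] by (auto simp: cyclic_bidiagonal_def)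
  have "det ?M = (\<Sum>j<n. ?M $$ (0, j) * cofactor ?M 0 j)"
    by (rule laplace_expansion_row[OF M n])
  also have "\<dots> = (\<Sum>j<n. (if j = 0 then d 0 * cofactor ?M 0 0 else 0)
                        + (if j = m then e m * cofactor ?M 0 m else 0))"
    by (intro sum.cong) (auto simp: entry0 algebra_simps)
  also have "\<dots> = d 0 * cofactor ?M 0 0 + e m * cofactor ?M 0 m"
    by (simp add: sum.distrib m)
  also have "cofactor ?M 0 0 = (\<Prod>j<m. d (Suc j))"
  proof -
    let ?N = "mat_delete ?M 0 0"
    have N: "?N \<in> carrier_mat m m"
      using mat_delete_carrier[of ?M "Suc m" "Suc m" 0 0] M by (simp add: m)
    have ent: "?N $$ (i, j) = (if i = j then d (Suc j) else 0) + (if i = Suc j then e (Suc j) else 0)"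
      if "i < m" "j < m" for i j
    proof -
      have "(Suc i = Suc (Suc j) mod Suc m) \<longleftrightarrow> i = Suc j"
        using that by (cases "Suc j = m") auto
      then show ?thesis
        using that by (simp add: mat_delete_def cyclic_bidiagonal_def m)
    qed
    have "det ?N = prod_list (diag_mat ?N)"
      by (rule det_lower_triangular[OF _ N]) (simp add: ent)
    also have "\<dots> = (\<Prod>j<m. d (Suc j))"
      by (simp only: prod_list_diag_prod carrier_matD[OF N]) (simp add: ent lessThan_atLeast0)
    finally show ?thesis by (simp add: cofactor_def)
  qed
  also have "cofactor ?M 0 m = (-1) ^ m * (\<Prod>j<m. e j)"
  proof -
    let ?N = "mat_delete ?M 0 m"
    have N: "?N \<in> carrier_mat m m"
      using mat_delete_carrier[of ?M "Suc m" "Suc m" 0 m] M by (simp add: m)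
    have ent: "?N $$ (i, j) = (if Suc i = j then d j else 0) + (if i = j then e j else 0)"
      if "i < m" "j < m" for i j
      using that by (auto simp: mat_delete_def cyclic_bidiagonal_def m)
    have "det ?N = prod_list (diag_mat ?N)"
      by (rule det_upper_triangular[OF _ N], rule upper_triangularI)
        (simp only: carrier_matD[OF N], simp add: ent)
    also have "\<dots> = (\<Prod>j<m. e j)"
      by (simp only: prod_list_diag_prod carrier_matD[OF N]) (simp add: ent lessThan_atLeast0)
    finally show ?thesis by (simp add: cofactor_def)
  qed
  finally show ?thesis
    unfolding m prod.lessThan_Suc_shift[of d] prod.lessThan_Suc[of e]
    by (simp add: algebra_simps)
qed

section \<open>Adjoints and unitary matrices\<close>

lemma dim_mat_adjoint [simp]:
  "dim_row (mat_adjoint M) = dim_col M" "dim_col (mat_adjoint M) = dim_row M"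
  by (simp_all add: mat_adjoint_def)

lemma index_mat_adjoint [simp]:
  "i < dim_col M \<Longrightarrow> j < dim_row M \<Longrightarrow> mat_adjoint M $$ (i, j) = conjugate (M $$ (j, i))"
  by (simp add: mat_adjoint_def mat_of_rows_index)

lemma mat_adjoint_carrier [simp]: "M \<in> carrier_mat n m \<Longrightarrow> mat_adjoint M \<in> carrier_mat m n"
  by auto

lemma mat_adjoint_adjoint [simp]: "mat_adjoint (mat_adjoint M) = M"
  by (rule eq_matI) auto

lemma mat_adjoint_mult:
  fixes X Y :: "'a::conjugatable_field mat"
  assumes "X \<in> carrier_mat n k" "Y \<in> carrier_mat k m"
  shows "mat_adjoint (X * Y) = mat_adjoint Y * mat_adjoint X"
  by (rule eq_matI)
    (use assms in \<open>auto simp: scalar_prod_def sum_conjugate conjugate_dist_mul mult.commute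
        intro!: sum.cong\<close>)

definition unitary_mat :: "nat \<Rightarrow> complex mat \<Rightarrow> bool" where
  "unitary_mat n U \<longleftrightarrow> U \<in> carrier_mat n n \<and> U * mat_adjoint U = 1\<^sub>m n"

lemma unitary_mat_left_inverse: "unitary_mat n U \<Longrightarrow> mat_adjoint U * U = 1\<^sub>m n"
  unfolding unitary_mat_def using mat_mult_left_right_inverse[of U n "mat_adjoint U"] by auto

lemma unitary_mat_adjoint: "unitary_mat n U \<Longrightarrow> unitary_mat n (mat_adjoint U)"
  using unitary_mat_left_inverse[of n U] by (auto simp: unitary_mat_def)

lemma unitary_mat_mult:
  assumes "unitary_mat n U" "unitary_mat n V"
  shows "unitary_mat n (U * V)"
proof -
  have car: "U \<in> carrier_mat n n" "V \<in> carrier_mat n n" "mat_adjoint U \<in> carrier_mat n n"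
    "mat_adjoint V \<in> carrier_mat n n"
    using assms by (auto simp: unitary_mat_def)
  have "U * V * mat_adjoint (U * V) = U * (V * mat_adjoint V) * mat_adjoint U"
    using car
    by (simp add: mat_adjoint_mult[of U n n V n] assoc_mult_mat[of _ n n _ n _ n] mult_carrier_mat[of _ n n _ n])
  also have "\<dots> = 1\<^sub>m n" using assms car by (simp add: unitary_mat_def)
  finally show ?thesis using car by (simp add: unitary_mat_def)
qed

lemma unitary_mat_diag:
  assumes "\<And>k. k < n \<Longrightarrow> cmod (f k) = 1"
  shows "unitary_mat n (mat_diag n f)"
proof -
  have "mat_adjoint (mat_diag n f) = mat_diag n (\<lambda>k. cnj (f k))"
    by (rule eq_matI) (auto simp: mat_diag_def)
  moreover have "mat_diag n (\<lambda>k. f k * cnj (f k)) = 1\<^sub>m n"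
    using assms by (intro eq_matI) (auto simp: mat_diag_def complex_norm_square[symmetric])
  ultimately show ?thesis by (simp add: unitary_mat_def)
qed

section \<open>Eigenvalues, trace and scalar unitary matrices\<close>

lemma not_invertible_iff_det_eq_0:
  fixes N :: "'a::field mat"
  assumes N: "N \<in> carrier_mat n n"
  shows "\<not> invertible_mat N \<longleftrightarrow> det N = 0"
proof
  assume "det N = 0"
  show "\<not> invertible_mat N"
  proof
    assume "invertible_mat N"
    then obtain K where K: "N * K = 1\<^sub>m n" "K * N = 1\<^sub>m (dim_row K)"
      using N by (auto simp: invertible_mat_def inverts_mat_def)
    have "K \<in> carrier_mat n n"
      using arg_cong[OF K(1), of dim_col] arg_cong[OF K(2), of dim_col] N by auto
    then have "det N * det K = 1" using K(1) det_mult[OF N] by (metis det_one)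
    with \<open>det N = 0\<close> show False by simp
  qed
next
  assume ni: "\<not> invertible_mat N"
  show "det N = 0"
  proof (rule ccontr)
    assume "det N \<noteq> 0"
    from det_non_zero_imp_unit[OF N this, of undefined] obtain K where
      "K \<in> carrier_mat n n" "N * K = 1\<^sub>m n" "K * N = 1\<^sub>m n"
      by (auto simp: Units_def ring_mat_def)
    then have "invertible_mat N"
      using N by (auto simp: invertible_mat_def inverts_mat_def)
    with ni show False ..
  qed
qed

definition mat_trace :: "'a::comm_monoid_add mat \<Rightarrow> 'a" where
  "mat_trace M = (\<Sum>i<dim_row M. M $$ (i, i))"

lemma mat_trace_comm:
  fixes X Y :: "'a::comm_semiring_0 mat"
  assumes "X \<in> carrier_mat n m" "Y \<in> carrier_mat m n"
  shows "mat_trace (X * Y) = mat_trace (Y * X)"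
proof -
  have "mat_trace (X * Y) = (\<Sum>i<n. \<Sum>k<m. X $$ (i, k) * Y $$ (k, i))"
    using assms by (simp add: mat_trace_def scalar_prod_def lessThan_atLeast0)
  also have "\<dots> = (\<Sum>k<m. \<Sum>i<n. Y $$ (k, i) * X $$ (i, k))"
    by (subst sum.swap) (simp add: mult.commute)
  also have "\<dots> = mat_trace (Y * X)"
    using assms by (simp add: mat_trace_def scalar_prod_def lessThan_atLeast0)
  finally show ?thesis .
qed

text \<open>
  Triangularisation moves the eigenvalues to the diagonal, and the trace is invariant under
  similarity.
\<close>

lemma mat_trace_single_eigenvalue:
  fixes C :: "complex mat"
  assumes C: "C \<in> carrier_mat n n"
    and ev: "\<And>\<mu>. eigenvalue C \<mu> \<Longrightarrow> \<mu> = w"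
  shows "mat_trace C = of_nat n * w"
proof -
  obtain es where es: "char_poly C = (\<Prod>a\<leftarrow>es. [:- a, 1:])" "length es = n"
    using char_poly_factorized[OF C] by blast
  obtain T P Q where "schur_decomposition C es = (T, P, Q)" by (metis prod_cases3)
  from schur_decomposition[OF C es(1) this]
  have sim: "similar_mat_wit C T P Q" and T: "diag_mat T = es" by auto
  have car: "T \<in> carrier_mat n n" "P \<in> carrier_mat n n" "Q \<in> carrier_mat n n"
    and QP: "Q * P = 1\<^sub>m n" and CPTQ: "C = P * T * Q"
    using sim C by (auto simp: similar_mat_wit_def Let_def)
  have diag: "T $$ (i, i) = w" if "i < n" for i
  proof -
    have "T $$ (i, i) \<in> set es" using that car by (auto simp: T[symmetric] diag_mat_def)
    then have "poly (char_poly C) (T $$ (i, i)) = 0"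
      unfolding es(1) by (rule linear_poly_root)
    then show ?thesis using ev eigenvalue_root_char_poly[OF C] by blast
  qed
  have "mat_trace C = mat_trace (P * (T * Q))" using car by (simp add: CPTQ)
  also have "\<dots> = mat_trace ((T * Q) * P)" using car by (intro mat_trace_comm) auto
  also have "(T * Q) * P = T" using car QP by simp
  also have "mat_trace T = of_nat n * w" using car by (simp add: mat_trace_def diag)
  finally show ?thesis .
qed

text \<open>
  The squared Frobenius distance from \<open>C\<close> to \<open>w I\<close> is \<open>n - 2 Re (cnj w * tr C) + n\<close>, because the
  rows of \<open>C\<close> are unit vectors. With \<open>tr C = n w\<close> this vanishes.
\<close>

lemma unitary_trace_extremal:
  fixes C :: "complex mat"
  assumes U: "unitary_mat n C"
    and tr: "mat_trace C = of_nat n * w" and w: "cmod w = 1"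
  shows "C = w \<cdot>\<^sub>m 1\<^sub>m n"
proof -
  have C: "C \<in> carrier_mat n n" and unitary: "C * mat_adjoint C = 1\<^sub>m n"
    using U by (auto simp: unitary_mat_def)
  have row: "(\<Sum>j<n. (cmod (C $$ (i, j)))\<^sup>2) = 1" if "i < n" for i
  proof -
    have "(C * mat_adjoint C) $$ (i, i) = (\<Sum>j<n. C $$ (i, j) * cnj (C $$ (i, j)))"
      using that C by (simp add: scalar_prod_def lessThan_atLeast0)
    then have "complex_of_real (\<Sum>j<n. (cmod (C $$ (i, j)))\<^sup>2) = 1"
      using unitary that by (simp add: complex_norm_square del: of_real_power)
    then show ?thesis using of_real_eq_1_iff by blast
  qed
  have "(\<Sum>j<n. (cmod (C $$ (i, j) - (if i = j then w else 0)))\<^sup>2) = 2 - 2 * Re (cnj w * C $$ (i, i))"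
    if i: "i < n" for i
  proof -
    have "(cmod (C $$ (i, j) - (if i = j then w else 0)))\<^sup>2
        = (cmod (C $$ (i, j)))\<^sup>2 + (if j = i then 1 - 2 * Re (cnj w * C $$ (i, i)) else 0)" for j
    proof -
      have "(cmod (z - w))\<^sup>2 = (cmod z)\<^sup>2 + 1 - 2 * Re (cnj w * z)" for z
      proof -
        have "(Re w)\<^sup>2 + (Im w)\<^sup>2 = 1" using w by (simp add: cmod_power2[symmetric])
        then show ?thesis by (simp only: cmod_power2) (simp add: power2_eq_square algebra_simps)
      qed
      then show ?thesis by auto
    qed
    then show ?thesis using i row[OF i] by (simp add: sum.distrib)
  qed
  then have "(\<Sum>i<n. \<Sum>j<n. (cmod (C $$ (i, j) - (if i = j then w else 0)))\<^sup>2)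
      = (\<Sum>i<n. 2 - 2 * Re (cnj w * C $$ (i, i)))" by simp
  also have "\<dots> = 2 * real n - 2 * Re (cnj w * mat_trace C)"
    using C by (simp add: sum_subtractf mat_trace_def sum_distrib_left[symmetric] Re_sum[symmetric] del: Re_sum)
  also have "cnj w * mat_trace C = of_nat n"
    using w by (simp add: tr complex_norm_square[symmetric] mult.commute mult.left_commute)
  finally have "(\<Sum>i<n. \<Sum>j<n. (cmod (C $$ (i, j) - (if i = j then w else 0)))\<^sup>2) = 0" by simp
  then have "C $$ (i, j) - (if i = j then w else 0) = 0" if "i < n" "j < n" for i j
    using that by (simp add: sum_nonneg_eq_0_iff sum_nonneg)
  then show ?thesis using C by (intro eq_matI) auto
qed

section \<open>The Weyl relation from the spectrum\<close>

text \<open>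
  The hypothesis prescribes where the pencil of the two products \<open>A * B\<close> and \<open>B * A\<close> is singular. It
  leaves no room for an eigenvalue \<open>\<mu> \<noteq> w\<close> of the commutator: \<open>A * B - \<mu> \<cdot>\<^sub>m (B * A)\<close> would have
  \<open>n\<close> distinct nonzero eigenvalues and the eigenvalue \<open>0\<close>.
\<close>

lemma weyl_relation_if_pencil_singular:
  fixes A B :: "complex mat"
  assumes n: "n > 0" and A: "unitary_mat n A" and B: "unitary_mat n B" and w: "cmod w = 1"
    and sing: "\<And>s t. (-1) ^ (n - 1) * (w * s + t) ^ n = 1 \<Longrightarrow>
                 det (s \<cdot>\<^sub>m (A * B) + t \<cdot>\<^sub>m (B * A) - 1\<^sub>m n) = 0"
  shows "A * B = w \<cdot>\<^sub>m (B * A)"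
proof -
  let ?A' = "mat_adjoint A" and ?B' = "mat_adjoint B"
  define C where "C = A * B * (?A' * ?B')"
  have car: "A \<in> carrier_mat n n" "B \<in> carrier_mat n n" "?A' \<in> carrier_mat n n" "?B' \<in> carrier_mat n n"
    using A B by (auto simp: unitary_mat_def)
  note carm = car mult_carrier_mat[of _ n n _ n]
  have UC: "unitary_mat n C"
    unfolding C_def by (intro unitary_mat_mult unitary_mat_adjoint A B)
  then have C: "C \<in> carrier_mat n n" by (simp add: unitary_mat_def)
  have inv1: "(?A' * ?B') * (B * A) = 1\<^sub>m n"
  proof -
    have "(?A' * ?B') * (B * A) = ?A' * ((?B' * B) * A)"
      using car by (simp add: assoc_mult_mat[of _ n n _ n _ n] mult_carrier_mat[of _ n n _ n])
    then show ?thesis using car A B by (simp add: unitary_mat_left_inverse)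
  qed
  then have inv2: "(B * A) * (?A' * ?B') = 1\<^sub>m n"
    using mat_mult_left_right_inverse[OF _ _ inv1] car by simp
  have ev: "\<mu> = w" if ev_C: "eigenvalue C \<mu>" for \<mu>
  proof (rule ccontr)
    assume ne: "\<mu> \<noteq> w"
    obtain v where v: "v \<in> carrier_vec n" "v \<noteq> 0\<^sub>v n" "C *\<^sub>v v = \<mu> \<cdot>\<^sub>v v"
      using ev_C C by (auto simp: eigenvalue_def eigenvector_def)
    define u where "u = (?A' * ?B') *\<^sub>v v"
    have u: "u \<in> carrier_vec n"
      unfolding u_def using car v(1) by (intro mult_mat_vec_carrier[of _ n n] mult_carrier_mat[of _ n n]) auto
    have BAu: "(B * A) *\<^sub>v u = v"
    proof -
      have "(B * A) *\<^sub>v u = ((B * A) * (?A' * ?B')) *\<^sub>v v"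
        unfolding u_def using car v by (intro assoc_mult_mat_vec[symmetric]) auto
      then show ?thesis using v by (simp add: inv2)
    qed
    have ABu: "(A * B) *\<^sub>v u = \<mu> \<cdot>\<^sub>v v"
    proof -
      have "(A * B) *\<^sub>v u = C *\<^sub>v v"
        unfolding u_def C_def using car v by (intro assoc_mult_mat_vec[symmetric]) auto
      then show ?thesis using v by simp
    qed
    have u0: "u \<noteq> 0\<^sub>v n"
    proof
      assume u0: "u = 0\<^sub>v n"
      have "(B * A) *\<^sub>v 0\<^sub>v n = 0\<^sub>v n" using car by (intro eq_vecI) (auto simp del: assoc_mult_mat_vec)
      then show False using BAu v(2) u0 by (simp del: assoc_mult_mat_vec)
    qed
    \<comment> \<open>\<open>u\<close> is a null vector of \<open>M\<close>, which accounts for the eigenvalue \<open>0\<close>\<close>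
    define M where "M = A * B - \<mu> \<cdot>\<^sub>m (B * A)"
    have M: "M \<in> carrier_mat n n" using car by (auto simp: M_def)
    have "M *\<^sub>v u = (A * B) *\<^sub>v u - (\<mu> \<cdot>\<^sub>m (B * A)) *\<^sub>v u"
      unfolding M_def using car u by (intro minus_mult_distrib_mat_vec) auto
    also have "(\<mu> \<cdot>\<^sub>m (B * A)) *\<^sub>v u = \<mu> \<cdot>\<^sub>v ((B * A) *\<^sub>v u)"
    proof -
      have "(\<mu> \<cdot>\<^sub>m K) *\<^sub>v u = \<mu> \<cdot>\<^sub>v (K *\<^sub>v u)" if "K \<in> carrier_mat n n" for K
        using that u by (intro eq_vecI) auto
      then show ?thesis using mult_carrier_mat[OF car(2,1)] by blast
    qed
    finally have "M *\<^sub>v u = 0\<^sub>v n" using v by (simp add: ABu BAu)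
    also have "0\<^sub>v n = 0 \<cdot>\<^sub>v u" using u by (intro eq_vecI) auto
    finally have "M *\<^sub>v u = 0 \<cdot>\<^sub>v u" .
    then have ev0: "eigenvalue M 0"
      using M u u0 by (auto simp: eigenvalue_def eigenvector_def)
    \<comment> \<open>the point \<open>(s, t) = (1 / z, - \<mu> / z)\<close> turns the pencil into \<open>(M - z I) / z\<close>, and it lies on
      the prescribed hypersurface exactly when \<open>z ^ n = c\<close>\<close>
    define c where "c = (-1) ^ (n - 1) * (w - \<mu>) ^ n"
    have c: "c \<noteq> 0" using ne by (auto simp: c_def)
    have evc: "eigenvalue M z" if z: "z ^ n = c" for z
    proof -
      have z0: "z \<noteq> 0" using z c n by (auto simp: power_0_left)
      have "(-1) ^ (n - 1) * (w * (1 / z) + (- \<mu> / z)) ^ n = (-1) ^ (n - 1) * ((w - \<mu>) / z) ^ n"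
        by (simp add: diff_divide_distrib)
      also have "\<dots> = c / z ^ n" by (simp add: c_def power_divide)
      also have "\<dots> = 1" using z c by simp
      finally have "det ((1 / z) \<cdot>\<^sub>m (A * B) + (- \<mu> / z) \<cdot>\<^sub>m (B * A) - 1\<^sub>m n) = 0" by (rule sing)
      also have "(1 / z) \<cdot>\<^sub>m (A * B) + (- \<mu> / z) \<cdot>\<^sub>m (B * A) - 1\<^sub>m n = (1 / z) \<cdot>\<^sub>m char_matrix M z"
        using car z0 by (intro eq_matI) (auto simp: M_def char_matrix_def field_simps)
      finally have "det (char_matrix M z) = 0" using z0 by simp
      then show ?thesis by (simp add: eigenvalue_det[OF M])
    qed
    have "insert 0 {z. z ^ n = c} \<subseteq> {z. poly (char_poly M) z = 0}"
      using ev0 evc by (auto simp: eigenvalue_root_char_poly[OF M])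
    moreover have nz: "char_poly M \<noteq> 0" and deg: "degree (char_poly M) = n"
      using degree_monic_char_poly[OF M] by auto
    ultimately have "card (insert 0 {z. z ^ n = c}) \<le> n"
      using card_mono[OF poly_roots_finite[OF nz]] card_poly_roots_bound[OF nz] deg
      by (metis (no_types, lifting) le_trans)
    moreover have "card {z. z ^ n = c} = n" by (rule card_nth_roots[OF c n])
    then have "card (insert 0 {z. z ^ n = c}) = Suc n"
      using c n by (subst card_insert_disjoint) (auto simp: power_0_left intro: card_ge_0_finite)
    ultimately show False by simp
  qed
  have "C = w \<cdot>\<^sub>m 1\<^sub>m n"
    by (rule unitary_trace_extremal[OF UC mat_trace_single_eigenvalue[OF C ev] w])
  moreover have "C * (B * A) = A * B"
  proof -
    have "C * (B * A) = (A * B) * ((?A' * ?B') * (B * A))"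
      unfolding C_def using carm by (intro assoc_mult_mat) auto
    then show ?thesis using car by (simp add: inv1)
  qed
  ultimately have "A * B = (w \<cdot>\<^sub>m 1\<^sub>m n) * (B * A)" by simp
  also have "\<dots> = w \<cdot>\<^sub>m (B * A)" using carm by (simp add: mult_smult_assoc_mat[of _ n n _ n])
  finally show ?thesis .
qed

section \<open>The spectrum for a weighted cyclic shift\<close>

lemma proj_spectrum_four:
  fixes A1 A2 A3 A4 :: "complex mat"
  assumes car: "A1 \<in> carrier_mat n n" "A2 \<in> carrier_mat n n" "A3 \<in> carrier_mat n n" "A4 \<in> carrier_mat n n"
  shows "proj_spectrum n [A1, A2, A3, A4] = {[x, y, z\<^sub>1, z\<^sub>2] | x y z\<^sub>1 z\<^sub>2.
    det (x \<cdot>\<^sub>m A1 + y \<cdot>\<^sub>m A2 + z\<^sub>1 \<cdot>\<^sub>m A3 + z\<^sub>2 \<cdot>\<^sub>m A4 - 1\<^sub>m n) = 0}"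
proof -
  have "mat_lin_comb n [x, y, z\<^sub>1, z\<^sub>2] [A1, A2, A3, A4]
      = x \<cdot>\<^sub>m A1 + y \<cdot>\<^sub>m A2 + z\<^sub>1 \<cdot>\<^sub>m A3 + z\<^sub>2 \<cdot>\<^sub>m A4" for x y z\<^sub>1 z\<^sub>2
    unfolding mat_lin_comb_def using car by (intro eq_matI) auto
  moreover have "\<not> invertible_mat (x \<cdot>\<^sub>m A1 + y \<cdot>\<^sub>m A2 + z\<^sub>1 \<cdot>\<^sub>m A3 + z\<^sub>2 \<cdot>\<^sub>m A4 - 1\<^sub>m n) \<longleftrightarrow>
      det (x \<cdot>\<^sub>m A1 + y \<cdot>\<^sub>m A2 + z\<^sub>1 \<cdot>\<^sub>m A3 + z\<^sub>2 \<cdot>\<^sub>m A4 - 1\<^sub>m n) = 0" for x y z\<^sub>1 z\<^sub>2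
    using car by (intro not_invertible_iff_det_eq_0) auto
  ultimately have mem: "[x, y, z\<^sub>1, z\<^sub>2] \<in> proj_spectrum n [A1, A2, A3, A4] \<longleftrightarrow>
      det (x \<cdot>\<^sub>m A1 + y \<cdot>\<^sub>m A2 + z\<^sub>1 \<cdot>\<^sub>m A3 + z\<^sub>2 \<cdot>\<^sub>m A4 - 1\<^sub>m n) = 0" for x y z\<^sub>1 z\<^sub>2
    by (simp add: proj_spectrum_def)
  have len: "length xs = 4" if "xs \<in> proj_spectrum n [A1, A2, A3, A4]" for xs
    using that by (simp add: proj_spectrum_def)
  have "\<exists>x y z\<^sub>1 z\<^sub>2. xs = [x, y, z\<^sub>1, z\<^sub>2]" if "length xs = 4" for xs :: "complex list"
    using that by (auto simp: length_Suc_conv numeral_eq_Suc)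
  with len mem show ?thesis by blast
qed

lemma prod_Suc_mod:
  fixes f :: "nat \<Rightarrow> 'a::comm_monoid_mult"
  shows "(\<Prod>l<n. f (Suc l mod n)) = (\<Prod>l<n. f l)"
proof (cases n)
  case (Suc m)
  have "(\<Prod>l<m. f (Suc l mod Suc m)) = (\<Prod>l<m. f (Suc l))" by (intro prod.cong) auto
  then show ?thesis
    unfolding Suc by (subst prod.lessThan_Suc, subst prod.lessThan_Suc_shift) (simp add: mult.commute)
qed simp

text \<open>
  With \<open>w = unit_root n\<close>: since \<open>B\<close> moves index \<open>l\<close> to \<open>l + 1\<close> modulo \<open>n\<close>, here \<open>A * B = w \<cdot>\<^sub>m (B * A)\<close>; hence \<open>z\<^sub>1\<close> and \<open>z\<^sub>2\<close> enter only
  through \<open>w z\<^sub>1 + z\<^sub>2\<close>. The weights \<open>c l / c (l + 1)\<close> multiply to \<open>1\<close> around the cycle, so they do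
  not affect the determinant.
\<close>

lemma det_weighted_shift_pencil:
  fixes c :: "nat \<Rightarrow> complex"
  assumes n: "n > 0" and c: "\<And>l. l < n \<Longrightarrow> c l \<noteq> 0"
    and A: "A = mat_diag n (\<lambda>k. unit_root n ^ k)"
    and B: "B = mat n n (\<lambda>(k, l). if k = Suc l mod n then c l / c k else 0)"
  shows "det (x \<cdot>\<^sub>m A + y \<cdot>\<^sub>m B + z\<^sub>1 \<cdot>\<^sub>m (A * B) + z\<^sub>2 \<cdot>\<^sub>m (B * A) - 1\<^sub>m n)
       = (-1) ^ n * (1 - (x ^ n + y ^ n + (-1) ^ (n - 1) * (unit_root n * z\<^sub>1 + z\<^sub>2) ^ n))"
proof -
  define z where "z = unit_root n * z\<^sub>1 + z\<^sub>2"
  let ?d = "\<lambda>l. x * unit_root n ^ l - 1"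
  let ?e = "\<lambda>l. c l / c (Suc l mod n) * (y + z * unit_root n ^ l)"
  have Bc: "B \<in> carrier_mat n n" by (simp add: B)
  have AB: "A * B = mat n n (\<lambda>(k, l). if k = Suc l mod n then unit_root n ^ Suc l * (c l / c k) else 0)"
    unfolding A mat_diag_mult_left[OF Bc]
    by (rule eq_matI) (auto simp: B unit_root_power_mod simp del: power_Suc)
  have BA: "B * A = mat n n (\<lambda>(k, l). if k = Suc l mod n then unit_root n ^ l * (c l / c k) else 0)"
    unfolding A mat_diag_mult_right[OF Bc] by (rule eq_matI) (auto simp: B)
  have "x \<cdot>\<^sub>m A + y \<cdot>\<^sub>m B + z\<^sub>1 \<cdot>\<^sub>m (A * B) + z\<^sub>2 \<cdot>\<^sub>m (B * A) - 1\<^sub>m n = cyclic_bidiagonal n ?d ?e"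
    unfolding AB BA
    by (rule eq_matI)
      (auto simp: A B mat_diag_def cyclic_bidiagonal_def z_def algebra_simps
        add_divide_distrib)
  moreover have "(\<Prod>l<n. ?d l) = (-1) ^ n * (1 - x ^ n)"
  proof -
    have "(\<Prod>l<n. ?d l) = (\<Prod>l<n. (-1) * (1 - x * unit_root n ^ l))" by simp
    then show ?thesis using prod_diff_unit_root[OF n, of 1 x] by (simp only: prod.distrib) simp
  qed
  moreover have "(\<Prod>l<n. ?e l) = y ^ n - (- z) ^ n"
  proof -
    have "(\<Prod>l<n. c l / c (Suc l mod n)) = 1"
      using c by (simp add: prod_dividef prod_Suc_mod[of c])
    then show ?thesis using prod_diff_unit_root[OF n, of y "-z"] by (simp only: prod.distrib) simp
  qed
  moreover obtain m where "n = Suc m" using n by (cases n) auto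
  ultimately show ?thesis
    unfolding z_def[symmetric] power_minus[of z]
    by (simp add: det_cyclic_bidiagonal algebra_simps flip: power_add mult_2)
qed

section \<open>Hadamard matrices equivalent to the Fourier matrix\<close>

lemma fourier_equivalent_iff_entries:
  assumes h: "h \<in> carrier_mat n n"
  shows "(\<exists>\<Lambda>\<^sub>1 \<Lambda>\<^sub>2. unimodular_diagonal_mat n \<Lambda>\<^sub>1 \<and> unimodular_diagonal_mat n \<Lambda>\<^sub>2 \<and>
            h = \<Lambda>\<^sub>1 * fourier_mat n * \<Lambda>\<^sub>2) \<longleftrightarrow>
         (\<exists>a c. (\<forall>i<n. cmod (a i) = 1 \<and> cmod (c i) = 1) \<and>
            (\<forall>j<n. \<forall>l<n. h $$ (j, l) = a j * unit_root n ^ (j * l) * c l))"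
    (is "?L \<longleftrightarrow> ?R")
proof -
  have F: "fourier_mat n = mat n n (\<lambda>(j, l). unit_root n ^ (j * l))"
  proof -
    have "exp (2 * of_real pi * \<i> * of_nat l * of_nat j / of_nat n) = unit_root n ^ (j * l)" for j l
      using exp_eq_unit_root_power[of "j * l" n] by (simp add: mult_ac)
    then show ?thesis by (simp add: fourier_mat_def)
  qed
  have prod: "mat_diag n a * fourier_mat n * mat_diag n c
      = mat n n (\<lambda>(j, l). a j * unit_root n ^ (j * l) * c l)" for a c
    unfolding F
    by (subst mat_diag_mult_left[of _ n n], simp, subst mat_diag_mult_right[of _ n n], simp, rule eq_matI) auto
  show ?thesis
  proof
    assume ?L
    then obtain D E where D: "unimodular_diagonal_mat n D" and E: "unimodular_diagonal_mat n E"
      and hDE: "h = D * fourier_mat n * E" by blast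
    have diag: "X = mat_diag n (\<lambda>i. X $$ (i, i))" if "unimodular_diagonal_mat n X" for X
      using that by (intro eq_matI) (auto simp: unimodular_diagonal_mat_def diagonal_mat_def mat_diag_def)
    have "h = mat n n (\<lambda>(j, l). D $$ (j, j) * unit_root n ^ (j * l) * E $$ (l, l))"
      unfolding hDE by (subst diag[OF D], subst diag[OF E]) (rule prod)
    then show ?R
      using D E by (intro exI[of _ "\<lambda>i. D $$ (i, i)"] exI[of _ "\<lambda>i. E $$ (i, i)"])
        (auto simp: unimodular_diagonal_mat_def)
  next
    assume ?R
    then obtain a c where ac: "\<forall>i<n. cmod (a i) = 1 \<and> cmod (c i) = 1"
      and ent: "\<forall>j<n. \<forall>l<n. h $$ (j, l) = a j * unit_root n ^ (j * l) * c l" by blast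
    have "h = mat_diag n a * fourier_mat n * mat_diag n c"
      unfolding prod using h ent by (intro eq_matI) auto
    moreover have "unimodular_diagonal_mat n (mat_diag n a)" "unimodular_diagonal_mat n (mat_diag n c)"
      using ac by (auto simp: unimodular_diagonal_mat_def diagonal_mat_def mat_diag_def)
    ultimately show ?L by blast
  qed
qed

lemma complex_hadamard_unitary:
  assumes n: "n > 0" and h: "complex_hadamard n h"
  shows "unitary_mat n (complex_of_real (1 / sqrt n) \<cdot>\<^sub>m h)"
proof -
  have car: "h \<in> carrier_mat n n" and unim: "\<And>i j. i < n \<Longrightarrow> j < n \<Longrightarrow> cmod (h $$ (i, j)) = 1"
    and orth: "\<And>i j. i < n \<Longrightarrow> j < n \<Longrightarrow> i \<noteq> j \<Longrightarrow> row h i \<bullet>c row h j = 0"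
    using h by (auto simp: complex_hadamard_def)
  let ?s = "complex_of_real (1 / sqrt n)"
  have s: "?s * ?s * of_nat n = 1"
  proof -
    have "1 / sqrt n * (1 / sqrt n) * real n = 1" using n by (simp add: field_simps)
    then have "complex_of_real (1 / sqrt n * (1 / sqrt n) * real n) = 1" by simp
    then show ?thesis by (simp only: of_real_mult of_real_of_nat_eq of_real_1)
  qed
  have "(?s \<cdot>\<^sub>m h) * mat_adjoint (?s \<cdot>\<^sub>m h) = 1\<^sub>m n"
  proof (rule eq_matI)
    fix i j assume "i < dim_row (1\<^sub>m n)" "j < dim_col (1\<^sub>m n)"
    then have ij: "i < n" "j < n" by auto
    have "((?s \<cdot>\<^sub>m h) * mat_adjoint (?s \<cdot>\<^sub>m h)) $$ (i, j)
        = ?s * ?s * (\<Sum>k<n. h $$ (i, k) * cnj (h $$ (j, k)))"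
      using ij car by (simp add: scalar_prod_def sum_distrib_left lessThan_atLeast0 mult_ac)
    also have "(\<Sum>k<n. h $$ (i, k) * cnj (h $$ (j, k))) = (if i = j then of_nat n else 0)"
    proof (cases "i = j")
      case True
      then show ?thesis using ij unim by (simp add: complex_norm_square[symmetric])
    next
      case False
      then show ?thesis using orth[OF ij] ij car by (simp add: scalar_prod_def lessThan_atLeast0)
    qed
    finally show "((?s \<cdot>\<^sub>m h) * mat_adjoint (?s \<cdot>\<^sub>m h)) $$ (i, j) = 1\<^sub>m n $$ (i, j)"
      using ij s by simp
  qed (use car in auto)
  then show ?thesis using car by (simp add: unitary_mat_def)
qed

text \<open>
  The factor \<open>1 / n\<close> is what makes \<open>B\<close> the conjugate of \<open>A\<close> by the unitary matrix \<open>h / \<surd>n\<close>. The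
  characterisation by \<open>h * X = A * h\<close> allows \<open>B\<close> to be recognised, and its entries to be related to
  those of \<open>h\<close>, without evaluating sums of roots of unity.
\<close>

lemma
  assumes n: "n > 0" and had: "complex_hadamard n h" and UA: "unitary_mat n A"
    and B: "B = (1 / of_nat n) \<cdot>\<^sub>m (mat_adjoint h * A * h)"
  shows unitary_hadamard_conjugate: "unitary_mat n B"
    and hadamard_conjugate_unique: "X \<in> carrier_mat n n \<Longrightarrow> X = B \<longleftrightarrow> h * X = A * h"
proof -
  have h: "h \<in> carrier_mat n n" using had by (simp add: complex_hadamard_def)
  define r where "r = complex_of_real (1 / sqrt n)"
  define U where "U = r \<cdot>\<^sub>m h"
  have UU: "unitary_mat n U" unfolding U_def r_def by (rule complex_hadamard_unitary[OF n had])
  have car: "A \<in> carrier_mat n n" "U \<in> carrier_mat n n" "mat_adjoint U \<in> carrier_mat n n"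
    using UA UU by (auto simp: unitary_mat_def)
  have r0: "r \<noteq> 0" using n by (simp add: r_def)
  have BU: "B = mat_adjoint U * A * U"
  proof -
    have "1 / sqrt n * (1 / sqrt n) = 1 / real n" using n by (simp add: field_simps)
    then have "complex_of_real (1 / sqrt n * (1 / sqrt n)) = complex_of_real (1 / real n)" by simp
    then have rr: "r * r = 1 / of_nat n"
      by (simp only: r_def of_real_mult of_real_divide of_real_1 of_real_of_nat_eq)
    have "mat_adjoint U = r \<cdot>\<^sub>m mat_adjoint h"
      unfolding U_def using h by (intro eq_matI) (auto simp: r_def)
    then have "mat_adjoint U * A * U = r \<cdot>\<^sub>m (r \<cdot>\<^sub>m (mat_adjoint h * A * h))"
      unfolding U_def using h car(1)
      by (simp add: mult_smult_assoc_mat[of _ n n _ n] mult_smult_distrib[of _ n n _ n] mult_carrier_mat[of _ n n _ n])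
    also have "\<dots> = B" unfolding B rr[symmetric] using h by (intro eq_matI) auto
    finally show ?thesis ..
  qed
  have UB: "unitary_mat n B"
    unfolding BU by (intro unitary_mat_mult unitary_mat_adjoint UU UA)
  have iff: "X = B \<longleftrightarrow> h * X = A * h" if X: "X \<in> carrier_mat n n" for X
  proof -
    have scale: "U * X = A * U \<longleftrightarrow> h * X = A * h"
    proof -
      have "U * X = r \<cdot>\<^sub>m (h * X)" "A * U = r \<cdot>\<^sub>m (A * h)"
        unfolding U_def using h X car(1)
        by (simp_all add: mult_smult_assoc_mat[of _ n n _ n] mult_smult_distrib[of _ n n _ n])
      moreover have "r \<cdot>\<^sub>m Y = r \<cdot>\<^sub>m Z \<longleftrightarrow> Y = Z" for Y Z
      proof
        assume "r \<cdot>\<^sub>m Y = r \<cdot>\<^sub>m Z"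
        then have "(1 / r) \<cdot>\<^sub>m (r \<cdot>\<^sub>m Y) = (1 / r) \<cdot>\<^sub>m (r \<cdot>\<^sub>m Z)" by simp
        moreover have "(1 / r) \<cdot>\<^sub>m (r \<cdot>\<^sub>m Y) = Y" for Y using r0 by (intro eq_matI) auto
        ultimately show "Y = Z" by simp
      qed simp
      ultimately show ?thesis by simp
    qed
    have "U * X = A * U" if "X = B"
    proof -
      have "U * B = (U * mat_adjoint U) * (A * U)"
        unfolding BU using car
        by (simp add: assoc_mult_mat[of _ n n _ n _ n] mult_carrier_mat[of _ n n _ n])
      then show ?thesis using UU car that by (simp add: unitary_mat_def)
    qed
    moreover have "X = B" if "U * X = A * U"
    proof -
      have "X = (mat_adjoint U * U) * X" using X UU by (simp add: unitary_mat_left_inverse)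
      also have "\<dots> = mat_adjoint U * (A * U)"
        using car X that by (simp add: assoc_mult_mat[of _ n n _ n _ n])
      also have "\<dots> = B" unfolding BU using car by (simp add: assoc_mult_mat[of _ n n _ n _ n])
      finally show ?thesis .
    qed
    ultimately show ?thesis using scale by blast
  qed
  show "unitary_mat n B" by (rule UB)
  show "X = B \<longleftrightarrow> h * X = A * h" if "X \<in> carrier_mat n n" using iff[OF that] .
qed

text \<open>
  With \<open>w = unit_root n\<close> and indices modulo \<open>n\<close>, the \<open>(k, l)\<close> entry of the Weyl relation reads
  \<open>w ^ k * B\<^sub>k\<^sub>l = w ^ (l + 1) * B\<^sub>k\<^sub>l\<close>, so column \<open>l\<close> of
  \<open>B\<close> is supported in row \<open>l + 1\<close>. Column \<open>l\<close> of \<open>h * B\<close> is therefore a multiple of column \<open>l + 1\<close>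
  of \<open>h\<close>, while column \<open>l\<close> of \<open>A * h\<close> is column \<open>l\<close> of \<open>h\<close> multiplied by \<open>w ^ j\<close> in row \<open>j\<close>. Reading the
  recursion in row \<open>0\<close>, where \<open>w ^ j = 1\<close>, identifies the unknown multiples.
\<close>

lemma fourier_entries_if_weyl_relation:
  assumes n: "n > 0" and h: "h \<in> carrier_mat n n" and Bc: "B \<in> carrier_mat n n"
    and h0: "\<And>i j. i < n \<Longrightarrow> j < n \<Longrightarrow> h $$ (i, j) \<noteq> 0"
    and A: "A = mat_diag n (\<lambda>k. unit_root n ^ k)"
    and hB: "h * B = A * h"
    and weyl: "A * B = unit_root n \<cdot>\<^sub>m (B * A)"
    and j: "j < n" and "l < n"
  shows "h $$ (j, l) = h $$ (j, 0) * unit_root n ^ (j * l) * (h $$ (0, l) / h $$ (0, 0))"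
proof -
  have supp: "B $$ (k, l) = 0" if k: "k < n" and l: "l < n" and ne: "k \<noteq> Suc l mod n" for k l
  proof -
    have "unit_root n ^ k * B $$ (k, l) = unit_root n * (B $$ (k, l) * unit_root n ^ l)"
      using arg_cong[OF weyl, of "\<lambda>X. X $$ (k, l)"] k l Bc
      unfolding A mat_diag_mult_left[OF Bc] mat_diag_mult_right[OF Bc] by simp
    then have "(unit_root n ^ k - unit_root n ^ (Suc l mod n)) * B $$ (k, l) = 0"
      by (simp add: unit_root_power_mod algebra_simps)
    moreover have "unit_root n ^ k \<noteq> unit_root n ^ (Suc l mod n)"
      using unit_root_power_inj[of n k "Suc l mod n"] k n ne by auto
    ultimately show ?thesis by simp
  qed
  have step: "h $$ (j, Suc l) * B $$ (Suc l, l) = unit_root n ^ j * h $$ (j, l)"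
    if j: "j < n" and l: "Suc l < n" for j l
  proof -
    have "(h * B) $$ (j, l) = unit_root n ^ j * h $$ (j, l)"
      unfolding hB using j l h unfolding A mat_diag_mult_left[OF h] by simp
    moreover have "(h * B) $$ (j, l) = (\<Sum>k<n. h $$ (j, k) * B $$ (k, l))"
      using j l h Bc by (simp add: scalar_prod_def lessThan_atLeast0)
    moreover have "\<dots> = (\<Sum>k<n. if k = Suc l then h $$ (j, k) * B $$ (k, l) else 0)"
      using l supp by (intro sum.cong) auto
    ultimately show ?thesis using l by simp
  qed
  show ?thesis
    using \<open>l < n\<close>
  proof (induction l)
    case 0
    then show ?case using h0[of 0 0] n by simp
  next
    case (Suc l)
    define b where "b = B $$ (Suc l, l)"
    have b: "h $$ (i, Suc l) * b = unit_root n ^ i * h $$ (i, l)" if "i < n" for i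
      unfolding b_def using step[OF that Suc.prems] .
    have b0: "b \<noteq> 0" using b[OF n] h0[of 0 l] Suc.prems n by auto
    have "h $$ (j, Suc l) * b = unit_root n ^ j * h $$ (j, l)" by (rule b[OF j])
    also have "\<dots> = h $$ (j, 0) * unit_root n ^ (j * Suc l) * (h $$ (0, l) / h $$ (0, 0))"
      using Suc by (simp add: power_add)
    also have "\<dots> = h $$ (j, 0) * unit_root n ^ (j * Suc l) * (h $$ (0, Suc l) / h $$ (0, 0)) * b"
      using b[OF n] by simp
    finally show ?case by (rule mult_right_cancel[OF b0, THEN iffD1])
  qed
qed

theorem corollary1p15:
  fixes n :: nat and h A B :: "complex mat"
  assumes "n \<ge> 1"
    and "complex_hadamard n h"
    and "A = mat_diag n (\<lambda>k. exp (2 * of_real pi * \<i> * of_nat k / of_nat n))"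
    and "B = (1 / of_nat n) \<cdot>\<^sub>m (mat_adjoint h * A * h)"
  shows "(\<exists>\<Lambda>\<^sub>1 \<Lambda>\<^sub>2. unimodular_diagonal_mat n \<Lambda>\<^sub>1 \<and> unimodular_diagonal_mat n \<Lambda>\<^sub>2 \<and>
            h = \<Lambda>\<^sub>1 * fourier_mat n * \<Lambda>\<^sub>2)
     \<longleftrightarrow>
     proj_spectrum n [A, B, A * B, B * A] =
       {[x, y, z\<^sub>1, z\<^sub>2] | x y z\<^sub>1 z\<^sub>2.
          x ^ n + y ^ n
            + (-1) ^ (n - 1) * (exp (2 * of_real pi * \<i> / of_nat n) * z\<^sub>1 + z\<^sub>2) ^ n = 1}"
proof -
  have n: "n > 0" using assms(1) by simp
  define w where "w = unit_root n"
  have w: "exp (2 * of_real pi * \<i> / of_nat n) = w" by (simp add: w_def unit_root_def)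
  have A: "A = mat_diag n (\<lambda>k. unit_root n ^ k)"
    unfolding assms(3) exp_eq_unit_root_power ..
  have h: "h \<in> carrier_mat n n" and unim: "\<And>i j. i < n \<Longrightarrow> j < n \<Longrightarrow> cmod (h $$ (i, j)) = 1"
    using assms(2) by (auto simp: complex_hadamard_def)
  have h0: "h $$ (i, j) \<noteq> 0" if "i < n" "j < n" for i j using unim[OF that] by auto
  have UA: "unitary_mat n A" unfolding A by (rule unitary_mat_diag) (simp add: norm_power)
  have UB: "unitary_mat n B" by (rule unitary_hadamard_conjugate[OF n assms(2) UA assms(4)])
  note B_iff = hadamard_conjugate_unique[OF n assms(2) UA assms(4)]
  have car: "A \<in> carrier_mat n n" and Bc: "B \<in> carrier_mat n n"
    using UA UB by (auto simp: unitary_mat_def)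
  have spec: "proj_spectrum n [A, B, A * B, B * A] = {[x, y, z\<^sub>1, z\<^sub>2] | x y z\<^sub>1 z\<^sub>2.
      det (x \<cdot>\<^sub>m A + y \<cdot>\<^sub>m B + z\<^sub>1 \<cdot>\<^sub>m (A * B) + z\<^sub>2 \<cdot>\<^sub>m (B * A) - 1\<^sub>m n) = 0}"
    using car Bc by (intro proj_spectrum_four) auto
  show ?thesis
    unfolding fourier_equivalent_iff_entries[OF h] w
  proof
    assume "\<exists>a c. (\<forall>i<n. cmod (a i) = 1 \<and> cmod (c i) = 1) \<and>
        (\<forall>j<n. \<forall>l<n. h $$ (j, l) = a j * unit_root n ^ (j * l) * c l)"
    then obtain a c where ac: "\<And>i. i < n \<Longrightarrow> cmod (a i) = 1 \<and> cmod (c i) = 1"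
      and ent: "\<And>j l. j < n \<Longrightarrow> l < n \<Longrightarrow> h $$ (j, l) = a j * unit_root n ^ (j * l) * c l"
      by blast
    have c0: "c l \<noteq> 0" if "l < n" for l using ac[OF that] by auto
    let ?X = "mat n n (\<lambda>(k, l). if k = Suc l mod n then c l / c k else 0)"
    have "h * ?X = A * h"
    proof (rule eq_matI)
      fix j l assume "j < dim_row (A * h)" "l < dim_col (A * h)"
      then have jl: "j < n" "l < n" using h car by auto
      have "(h * ?X) $$ (j, l) = (\<Sum>k<n. h $$ (j, k) * ?X $$ (k, l))"
        using jl h by (simp add: scalar_prod_def lessThan_atLeast0)
      also have "\<dots> = (\<Sum>k<n. if k = Suc l mod n then h $$ (j, k) * (c l / c k) else 0)"
        using jl by (intro sum.cong) auto
      also have "\<dots> = h $$ (j, Suc l mod n) * (c l / c (Suc l mod n))"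
        using n by simp
      also have "\<dots> = a j * unit_root n ^ (j * (Suc l mod n)) * c l"
        using jl n c0[of "Suc l mod n"] by (simp add: ent)
      also have "unit_root n ^ (j * (Suc l mod n)) = unit_root n ^ (j * Suc l)"
        by (metis mod_mult_right_eq unit_root_power_mod)
      also have "a j * unit_root n ^ (j * Suc l) * c l = (A * h) $$ (j, l)"
        using jl h unfolding A mat_diag_mult_left[OF h] by (simp add: ent power_add)
      finally show "(h * ?X) $$ (j, l) = (A * h) $$ (j, l)" .
    qed (use h car in auto)
    then have B: "B = ?X" using B_iff[of ?X] by simp
    have "det (x \<cdot>\<^sub>m A + y \<cdot>\<^sub>m B + z\<^sub>1 \<cdot>\<^sub>m (A * B) + z\<^sub>2 \<cdot>\<^sub>m (B * A) - 1\<^sub>m n) = 0 \<longleftrightarrow>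
        x ^ n + y ^ n + (-1) ^ (n - 1) * (w * z\<^sub>1 + z\<^sub>2) ^ n = 1" for x y z\<^sub>1 z\<^sub>2
      using det_weighted_shift_pencil[OF n c0 A B, of x y z\<^sub>1 z\<^sub>2] by (auto simp: w_def)
    then show "proj_spectrum n [A, B, A * B, B * A] = {[x, y, z\<^sub>1, z\<^sub>2] | x y z\<^sub>1 z\<^sub>2.
        x ^ n + y ^ n + (-1) ^ (n - 1) * (w * z\<^sub>1 + z\<^sub>2) ^ n = 1}"
      unfolding spec by simp
  next
    assume eq: "proj_spectrum n [A, B, A * B, B * A] = {[x, y, z\<^sub>1, z\<^sub>2] | x y z\<^sub>1 z\<^sub>2.
        x ^ n + y ^ n + (-1) ^ (n - 1) * (w * z\<^sub>1 + z\<^sub>2) ^ n = 1}"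
    have weyl: "A * B = w \<cdot>\<^sub>m (B * A)"
    proof (rule weyl_relation_if_pencil_singular[OF n UA UB])
      show "cmod w = 1" by (simp add: w_def)
      fix s t :: complex assume st: "(-1) ^ (n - 1) * (w * s + t) ^ n = 1"
      then have "[0, 0, s, t] \<in> proj_spectrum n [A, B, A * B, B * A]"
        unfolding eq using n by (simp add: power_0_left)
      then have "det (0 \<cdot>\<^sub>m A + 0 \<cdot>\<^sub>m B + s \<cdot>\<^sub>m (A * B) + t \<cdot>\<^sub>m (B * A) - 1\<^sub>m n) = 0"
        unfolding spec by simp
      also have "0 \<cdot>\<^sub>m A + 0 \<cdot>\<^sub>m B + s \<cdot>\<^sub>m (A * B) + t \<cdot>\<^sub>m (B * A) - 1\<^sub>m n
          = s \<cdot>\<^sub>m (A * B) + t \<cdot>\<^sub>m (B * A) - 1\<^sub>m n"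
        using car Bc by (intro eq_matI) auto
      finally show "det (s \<cdot>\<^sub>m (A * B) + t \<cdot>\<^sub>m (B * A) - 1\<^sub>m n) = 0" .
    qed
    have hB: "h * B = A * h" using B_iff[OF Bc] by simp
    note form = fourier_entries_if_weyl_relation[OF n h Bc h0 A hB weyl[unfolded w_def]]
    show "\<exists>a c. (\<forall>i<n. cmod (a i) = 1 \<and> cmod (c i) = 1) \<and>
        (\<forall>j<n. \<forall>l<n. h $$ (j, l) = a j * unit_root n ^ (j * l) * c l)"
    proof (intro exI conjI allI impI)
      fix j l assume jl: "j < n" "l < n"
      show "h $$ (j, l) = h $$ (j, 0) * unit_root n ^ (j * l) * (h $$ (0, l) / h $$ (0, 0))"
        by (rule form) (use jl in auto)
    qed (use unim n in \<open>simp_all add: norm_divide\<close>)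
  qed
qed

end
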